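(* For every $n\geq 0$ and every $P\in\mathcal{D}_n^{h,\geq}$, $$\#UDU(P)=\#FF(\phi(P))+\#FUD(\phi(P)).$$
   Context: A Motzkin path of length $n$ is a word in the steps $U=(1,1)$, $D=(1,-1)$, $F=(1,0)$ forming a lattice path from $(0,0)$ to $(n,0)$ never going below the $x$-axis; $\mathcal{M}_n$ is the set of them. A Dyck path of semilength $n$ is a Motzkin path of length $2n$ without $F$ steps. Every nonempty Dyck path has a unique first return decomposition $P=U\alpha D\beta$ with $\alpha,\beta$ Dyck paths; $h$ denotes maximal height. $\mathcal{D}^{h,\geq}$ is defined recursively: it contains the empty path $\epsilon$, and $P=U\alpha D\beta$ belongs to it iff $\alpha,\beta\in\mathcal{D}^{h,\geq}$ and $h(U\alpha D)\geq h(\beta)$; $\mathcal{D}_n^{h,\geq}$ is the subset of semilength $n$. The bijection $\phi:\mathcal{D}_n^{h,\geq}\to\mathcal{M}_n$ is defined by $\phi(\epsilon)=\epsilon$, $\phi(\alpha UD)=\phi(\alpha)F$, $\phi(\alpha UU\beta D\gamma D)=\phi(\alpha)\phi(\gamma)U\phi(\beta)D$. For a word $X$, $\#X(P)$ is the number of occurrences of $X$ as consecutive steps in $P$. *)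

theory Defs
  imports Main
begin

datatype step = U | D | F

type_synonym path = "step list"

fun rise :: "step \<Rightarrow> int" where
  "rise U = 1"
| "rise D = -1"
| "rise F = 0"

definition end_height :: "path \<Rightarrow> int" where
  "end_height w = (\<Sum>s\<leftarrow>w. rise s)"

definition Motzkin :: "nat \<Rightarrow> path set" where
  "Motzkin n = {w. length w = n \<and> end_height w = 0 \<and> (\<forall>k\<le>n. 0 \<le> end_height (take k w))}"

definition Dyck :: "nat \<Rightarrow> path set" where
  "Dyck n = {w \<in> Motzkin (2 * n). F \<notin> set w}"

definition Dyck_paths :: "path set" where
  "Dyck_paths = (\<Union>n. Dyck n)"

definition max_height :: "path \<Rightarrow> int" where
  "max_height w = Max ((\<lambda>k. end_height (take k w)) ` {..length w})"

text \<open>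
  By uniqueness of the first return decomposition, the inductive rules below are equivalent to the
  recursive membership criterion (see \<open>Dh_first_return_iff\<close>).
\<close>
inductive_set Dh :: "path set" where
  empty: "[] \<in> Dh"
| first_return: "U # \<alpha> @ D # \<beta> \<in> Dh"
    if "\<alpha> \<in> Dh" and "\<beta> \<in> Dh" and "max_height (U # \<alpha> @ [D]) \<ge> max_height \<beta>"

definition Dhn :: "nat \<Rightarrow> path set" where
  "Dhn n = {P \<in> Dh. length P = 2 * n}"

definition occ :: "path \<Rightarrow> path \<Rightarrow> nat" where
  "occ X w = card {i. i + length X \<le> length w \<and> take (length X) (drop i w) = X}"


lemma end_height_simps [simp]:
  "end_height [] = 0"
  "end_height (s # w) = rise s + end_height w"
  "end_height (v @ w) = end_height v + end_height w"
  by (simp_all add: end_height_def)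

lemma even_length_end_height:
  assumes "F \<notin> set w"
  shows "even (int (length w) + end_height w)"
  using assms
proof (induction w)
  case (Cons s w)
  then show ?case by (cases s) auto
qed simp

lemma Dyck_paths_iff:
  "w \<in> Dyck_paths \<longleftrightarrow>
     F \<notin> set w \<and> end_height w = 0 \<and> (\<forall>u v. w = u @ v \<longrightarrow> 0 \<le> end_height u)"
  (is "?L \<longleftrightarrow> ?R")
proof
  assume ?L
  then obtain n where n: "length w = 2 * n" "end_height w = 0" "F \<notin> set w"
    "\<And>k. k \<le> 2 * n \<Longrightarrow> 0 \<le> end_height (take k w)"
    by (auto simp: Dyck_paths_def Dyck_def Motzkin_def)
  have "0 \<le> end_height u" if "w = u @ v" for u v
    using n(4)[of "length u"] n(1) that by simp
  with n show ?R by blast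
next
  assume R: ?R
  then have "even (length w)" using even_length_end_height[of w] by simp
  then obtain n where n: "length w = 2 * n" by (elim evenE)
  have "0 \<le> end_height (take k w)" for k
    using R append_take_drop_id[of k w] by metis
  with R n have "w \<in> Dyck n" by (auto simp: Dyck_def Motzkin_def)
  then show ?L by (auto simp: Dyck_paths_def)
qed

lemma Dyck_paths_Nil [simp]: "[] \<in> Dyck_paths"
  by (simp add: Dyck_paths_iff)

lemma Dyck_paths_append:
  assumes "v \<in> Dyck_paths" "w \<in> Dyck_paths"
  shows "v @ w \<in> Dyck_paths"
proof -
  have "0 \<le> end_height u" if "v @ w = u @ x" for u x
  proof -
    from that obtain us where "v = u @ us \<or> v @ us = u \<and> w = us @ x"
      unfolding append_eq_append_conv2 by blast
    then show ?thesis
    proof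
      assume "v = u @ us"
      with assms(1) show ?thesis by (auto simp: Dyck_paths_iff)
    next
      assume *: "v @ us = u \<and> w = us @ x"
      with assms(2) have "0 \<le> end_height us" by (auto simp: Dyck_paths_iff)
      moreover have "end_height v = 0" using assms(1) by (simp add: Dyck_paths_iff)
      ultimately show ?thesis using * by auto
    qed
  qed
  with assms show ?thesis by (simp add: Dyck_paths_iff)
qed

lemma Dyck_paths_arch:
  assumes "v \<in> Dyck_paths"
  shows "U # v @ [D] \<in> Dyck_paths"
proof -
  have "0 \<le> end_height u" if eq: "U # v @ [D] = u @ x" for u x
  proof (cases u)
    case (Cons s u')
    with eq have s: "s = U" and "v @ [D] = u' @ x" by auto
    then have "(\<exists>y. v = u' @ y) \<or> u' = v @ [D]"
      by (auto simp: append_eq_append_conv2 Cons_eq_append_conv append_eq_Cons_conv)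
    with assms Cons s show ?thesis by (auto simp: Dyck_paths_iff)
  qed simp
  with assms show ?thesis by (auto simp: Dyck_paths_iff)
qed

lemma first_return_unique:
  assumes "\<alpha> @ D # \<beta> = \<alpha>' @ D # \<beta>'" "\<alpha> \<in> Dyck_paths" "\<alpha>' \<in> Dyck_paths"
  shows "\<alpha> = \<alpha>' \<and> \<beta> = \<beta>'"
proof -
  have *: "us = []" if that: "v @ us \<in> Dyck_paths" "v \<in> Dyck_paths" and eq: "us @ D # x = D # y" for us v x y
  proof (rule ccontr)
    assume ne: "us \<noteq> []"
    then obtain vs where "us = D # vs" using eq by (cases us) auto
    with that(1) have "0 \<le> end_height (v @ [D])"
      unfolding Dyck_paths_iff by (metis append.assoc append_Cons append_Nil)
    with that(2) show False by (simp add: Dyck_paths_iff)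
  qed
  from assms(1) obtain us where
    "\<alpha> = \<alpha>' @ us \<and> us @ D # \<beta> = D # \<beta>' \<or> \<alpha> @ us = \<alpha>' \<and> D # \<beta> = us @ D # \<beta>'"
    unfolding append_eq_append_conv2 by blast
  then show ?thesis
  proof
    assume "\<alpha> = \<alpha>' @ us \<and> us @ D # \<beta> = D # \<beta>'"
    with *[of \<alpha>' us \<beta> \<beta>'] assms show ?thesis by simp
  next
    assume "\<alpha> @ us = \<alpha>' \<and> D # \<beta> = us @ D # \<beta>'"
    moreover from this have "us = []" using *[of \<alpha> us \<beta>' \<beta>] assms by metis
    ultimately show ?thesis by simp
  qed
qed

lemma last_return_unique:
  assumes "\<alpha> @ U # \<gamma> = \<alpha>' @ U # \<gamma>'"
    and "\<alpha> \<in> Dyck_paths" "\<alpha>' \<in> Dyck_paths" "\<gamma> \<in> Dyck_paths" "\<gamma>' \<in> Dyck_paths"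
  shows "\<alpha> = \<alpha>' \<and> \<gamma> = \<gamma>'"
proof -
  have *: "us = []" if that: "v @ us \<in> Dyck_paths" "v \<in> Dyck_paths" and eq: "us @ U # x = U # y"
      and y: "y \<in> Dyck_paths" for us v x y
  proof (rule ccontr)
    assume ne: "us \<noteq> []"
    then obtain vs where vs: "us = U # vs" "y = vs @ U # x" using eq by (cases us) auto
    then have "0 \<le> end_height vs" using y by (auto simp: Dyck_paths_iff)
    with vs that(1,2) show False by (simp add: Dyck_paths_iff)
  qed
  from assms(1) obtain us where
    "\<alpha> = \<alpha>' @ us \<and> us @ U # \<gamma> = U # \<gamma>' \<or> \<alpha> @ us = \<alpha>' \<and> U # \<gamma> = us @ U # \<gamma>'"
    unfolding append_eq_append_conv2 by blast
  then show ?thesis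
  proof
    assume "\<alpha> = \<alpha>' @ us \<and> us @ U # \<gamma> = U # \<gamma>'"
    with *[of \<alpha>' us \<gamma> \<gamma>'] assms show ?thesis by simp
  next
    assume "\<alpha> @ us = \<alpha>' \<and> U # \<gamma> = us @ U # \<gamma>'"
    moreover from this have "us = []" using *[of \<alpha> us \<gamma>' \<gamma>] assms by metis
    ultimately show ?thesis by simp
  qed
qed

lemma first_descent:
  assumes "end_height w < 0" "F \<notin> set w"
  shows "\<exists>\<alpha> \<beta>. w = \<alpha> @ D # \<beta> \<and> \<alpha> \<in> Dyck_paths"
proof -
  define k where "k = (LEAST k. end_height (take k w) < 0)"
  have k: "end_height (take k w) < 0"
    unfolding k_def by (rule LeastI[of _ "length w"]) (use assms in simp)
  have small: "0 \<le> end_height (take j w)" if "j < k" for j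
    using that not_less_Least[of j "\<lambda>k. end_height (take k w) < 0"] by (simp add: k_def)
  from k obtain m where m: "k = Suc m" by (cases k) auto
  have mw: "m < length w"
    using k small[of m] m by (cases "m < length w") auto
  have tk: "take k w = take m w @ [w ! m]" using mw m by (simp add: take_Suc_conv_app_nth)
  have nonneg: "0 \<le> end_height (take m w)" using small m by simp
  have D: "w ! m = D" and z: "end_height (take m w) = 0"
    using k nonneg unfolding tk by (cases "w ! m"; simp)+
  have "0 \<le> end_height u" if "take m w = u @ v" for u v
  proof -
    from that have "u = take (length u) (take m w)" by simp
    moreover from that mw have "length u \<le> m"
      by (metis append_eq_conv_conj length_take min.absorb2 min.bounded_iff nat_le_linear take_all_iff
          length_append le_add1 less_imp_le)
    ultimately have "u = take (length u) w" by (simp add: min_absorb1)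
    with small[of "length u"] \<open>length u \<le> m\<close> m show ?thesis by simp
  qed
  then have "take m w \<in> Dyck_paths"
    using z assms(2) by (auto simp: Dyck_paths_iff dest: in_set_takeD)
  moreover have "w = take m w @ D # drop (Suc m) w"
    using id_take_nth_drop[OF mw] D by simp
  ultimately show ?thesis by blast
qed

lemma first_return_exists:
  assumes "w \<in> Dyck_paths" "w \<noteq> []"
  obtains \<alpha> \<beta> where "w = U # \<alpha> @ D # \<beta>" "\<alpha> \<in> Dyck_paths" "\<beta> \<in> Dyck_paths"
proof -
  obtain s v where w: "w = s # v" using assms(2) by (cases w) auto
  then have "w = [s] @ v" by simp
  then have "0 \<le> end_height [s]" "s \<noteq> F" using assms(1) unfolding Dyck_paths_iff by (blast, force)
  then have s: "s = U" by (cases s) auto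
  with w assms(1) have "end_height v < 0" "F \<notin> set v" by (auto simp: Dyck_paths_iff)
  from first_descent[OF this] obtain \<alpha> \<beta> where v: "v = \<alpha> @ D # \<beta>" "\<alpha> \<in> Dyck_paths" by blast
  have "0 \<le> end_height x" if "\<beta> = x @ y" for x y
  proof -
    have "w = (U # \<alpha> @ D # x) @ y" using that v s w by simp
    then have "0 \<le> end_height (U # \<alpha> @ D # x)" using assms(1) by (metis Dyck_paths_iff)
    with v show ?thesis by (simp add: Dyck_paths_iff)
  qed
  then have "\<beta> \<in> Dyck_paths" using assms(1) v s w by (auto simp: Dyck_paths_iff)
  with v s w show thesis using that by blast
qed

lemma last_return_exists:
  assumes "w \<in> Dyck_paths" "w \<noteq> []"
  shows "\<exists>\<alpha> \<gamma>. w = \<alpha> @ U # \<gamma> @ [D] \<and> \<alpha> \<in> Dyck_paths \<and> \<gamma> \<in> Dyck_paths"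
  using assms
proof (induction w rule: length_induct)
  case (1 w)
  then obtain \<alpha> \<beta> where w: "w = U # \<alpha> @ D # \<beta>" "\<alpha> \<in> Dyck_paths" "\<beta> \<in> Dyck_paths"
    using first_return_exists by blast
  show ?case
  proof (cases "\<beta> = []")
    case True
    with w have "w = [] @ U # \<alpha> @ [D]" by simp
    with w show ?thesis using Dyck_paths_Nil by blast
  next
    case False
    moreover have "length \<beta> < length w" using w by simp
    ultimately obtain \<alpha>' \<gamma> where \<beta>: "\<beta> = \<alpha>' @ U # \<gamma> @ [D]" "\<alpha>' \<in> Dyck_paths" "\<gamma> \<in> Dyck_paths"
      using 1(1) w(3) by blast
    have "w = ((U # \<alpha> @ [D]) @ \<alpha>') @ U # \<gamma> @ [D]" using w \<beta> by simp
    then show ?thesis using \<beta> Dyck_paths_append[OF Dyck_paths_arch[OF w(2)] \<beta>(2)] by blast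
  qed
qed

lemma phi_cases:
  obtains "w = []"
  | \<alpha> where "\<alpha> \<in> Dyck_paths" "w = \<alpha> @ [U, D]"
  | \<alpha> \<beta> \<gamma> where "\<alpha> \<in> Dyck_paths" "\<beta> \<in> Dyck_paths" "\<gamma> \<in> Dyck_paths"
      "w = \<alpha> @ [U, U] @ \<beta> @ [D] @ \<gamma> @ [D]"
  | "w \<notin> Dyck_paths"
proof (cases "w \<in> Dyck_paths \<and> w \<noteq> []")
  case True
  then obtain \<alpha> \<delta> where w: "w = \<alpha> @ U # \<delta> @ [D]" "\<alpha> \<in> Dyck_paths" "\<delta> \<in> Dyck_paths"
    using last_return_exists by blast
  show thesis
  proof (cases "\<delta> = []")
    case False
    then obtain \<beta> \<gamma> where "\<delta> = U # \<beta> @ D # \<gamma>" "\<beta> \<in> Dyck_paths" "\<gamma> \<in> Dyck_paths"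
      using first_return_exists w(3) by blast
    with w show thesis by (intro that(3)) auto
  qed (use w that(2) in auto)
qed (use that in blast)

lemma Dyck_paths_UD: "\<alpha> \<in> Dyck_paths \<Longrightarrow> \<alpha> @ [U, D] \<in> Dyck_paths"
  using Dyck_paths_append[OF _ Dyck_paths_arch[OF Dyck_paths_Nil]] by simp

lemma Dyck_paths_first: "\<beta> \<in> Dyck_paths \<Longrightarrow> \<gamma> \<in> Dyck_paths \<Longrightarrow> U # \<beta> @ D # \<gamma> \<in> Dyck_paths"
  using Dyck_paths_append[OF Dyck_paths_arch, of \<beta> \<gamma>] by simp

lemma Dyck_paths_UUDD:
  "\<alpha> \<in> Dyck_paths \<Longrightarrow> \<beta> \<in> Dyck_paths \<Longrightarrow> \<gamma> \<in> Dyck_paths \<Longrightarrow>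
     \<alpha> @ [U, U] @ \<beta> @ [D] @ \<gamma> @ [D] \<in> Dyck_paths"
  using Dyck_paths_append[OF _ Dyck_paths_arch[OF Dyck_paths_first[of \<beta> \<gamma>]], of \<alpha>] by simp

lemma UD_unique: "\<alpha> @ [U, D] = \<alpha>' @ [U, D] \<Longrightarrow> \<alpha> = \<alpha>'"
  by simp

lemma UD_UUDD_disjoint:
  assumes "\<alpha> @ [U, D] = \<alpha>' @ [U, U] @ \<beta> @ [D] @ \<gamma> @ [D]"
    and "\<alpha> \<in> Dyck_paths" "\<alpha>' \<in> Dyck_paths" "\<beta> \<in> Dyck_paths" "\<gamma> \<in> Dyck_paths"
  shows False
proof -
  have "(\<alpha> @ [U]) @ [D] = (\<alpha>' @ U # (U # \<beta> @ D # \<gamma>)) @ [D]" using assms(1) by simp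
  then have "\<alpha> @ U # [] = \<alpha>' @ U # (U # \<beta> @ D # \<gamma>)" by blast
  from last_return_unique[OF this] assms(2-) Dyck_paths_first show False by simp
qed

lemma UUDD_unique:
  assumes "\<alpha> @ [U, U] @ \<beta> @ [D] @ \<gamma> @ [D] = \<alpha>' @ [U, U] @ \<beta>' @ [D] @ \<gamma>' @ [D]"
    and "\<alpha> \<in> Dyck_paths" "\<beta> \<in> Dyck_paths" "\<gamma> \<in> Dyck_paths"
    and "\<alpha>' \<in> Dyck_paths" "\<beta>' \<in> Dyck_paths" "\<gamma>' \<in> Dyck_paths"
  shows "\<alpha> = \<alpha>' \<and> \<beta> = \<beta>' \<and> \<gamma> = \<gamma>'"
proof -
  have "(\<alpha> @ U # (U # \<beta> @ D # \<gamma>)) @ [D] = (\<alpha>' @ U # (U # \<beta>' @ D # \<gamma>')) @ [D]"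
    using assms(1) by simp
  then have "\<alpha> @ U # (U # \<beta> @ D # \<gamma>) = \<alpha>' @ U # (U # \<beta>' @ D # \<gamma>')" by blast
  from last_return_unique[OF this] assms(2-) Dyck_paths_first
  have *: "\<alpha> = \<alpha>'" "\<beta> @ D # \<gamma> = \<beta>' @ D # \<gamma>'" by simp_all
  with first_return_unique[OF *(2)] assms show ?thesis by simp
qed

text \<open>
  The recursion makes sense for every Dyck path, so \<^term>\<open>phi\<close> is defined on all of them; the
  decompositions in the guarded equations are exhaustive and unique. On \<^term>\<open>Dh\<close> it is the
  intended map, since the pieces of a path in \<^term>\<open>Dh\<close> are again in \<^term>\<open>Dh\<close>
  (see \<open>Dh_UD_D\<close> and \<open>Dh_UUDD_D\<close> below). Values outside the Dyck paths are irrelevant.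
\<close>
function phi :: "path \<Rightarrow> path" where
  "phi [] = []"
| "\<alpha> \<in> Dyck_paths \<Longrightarrow> phi (\<alpha> @ [U, D]) = phi \<alpha> @ [F]"
| "\<alpha> \<in> Dyck_paths \<Longrightarrow> \<beta> \<in> Dyck_paths \<Longrightarrow> \<gamma> \<in> Dyck_paths \<Longrightarrow>
     phi (\<alpha> @ [U, U] @ \<beta> @ [D] @ \<gamma> @ [D]) = phi \<alpha> @ phi \<gamma> @ [U] @ phi \<beta> @ [D]"
| "w \<notin> Dyck_paths \<Longrightarrow> phi w = undefined"
proof -
  fix P :: bool and w
  assume "w = [] \<Longrightarrow> P"
    "\<And>\<alpha>. \<alpha> \<in> Dyck_paths \<Longrightarrow> w = \<alpha> @ [U, D] \<Longrightarrow> P"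
    "\<And>\<alpha> \<beta> \<gamma>. \<alpha> \<in> Dyck_paths \<Longrightarrow> \<beta> \<in> Dyck_paths \<Longrightarrow> \<gamma> \<in> Dyck_paths \<Longrightarrow>
       w = \<alpha> @ [U, U] @ \<beta> @ [D] @ \<gamma> @ [D] \<Longrightarrow> P"
    "\<And>v. v \<notin> Dyck_paths \<Longrightarrow> w = v \<Longrightarrow> P"
  then show P using phi_cases[of w P] by blast
next
  fix \<alpha> \<alpha>' \<beta> \<gamma>
  assume "\<alpha> \<in> Dyck_paths" "\<alpha>' \<in> Dyck_paths" "\<beta> \<in> Dyck_paths" "\<gamma> \<in> Dyck_paths"
    "\<alpha> @ [U, D] = \<alpha>' @ [U, U] @ \<beta> @ [D] @ \<gamma> @ [D]"
  with UD_UUDD_disjoint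
  show "phi_sumC \<alpha> @ [F] = phi_sumC \<alpha>' @ phi_sumC \<gamma> @ [U] @ phi_sumC \<beta> @ [D]" by blast
next
  fix \<alpha> \<beta> \<gamma> \<alpha>' \<beta>' \<gamma>'
  assume "\<alpha> \<in> Dyck_paths" "\<beta> \<in> Dyck_paths" "\<gamma> \<in> Dyck_paths"
    "\<alpha>' \<in> Dyck_paths" "\<beta>' \<in> Dyck_paths" "\<gamma>' \<in> Dyck_paths"
    "\<alpha> @ [U, U] @ \<beta> @ [D] @ \<gamma> @ [D] = \<alpha>' @ [U, U] @ \<beta>' @ [D] @ \<gamma>' @ [D]"
  with UUDD_unique have "\<alpha> = \<alpha>' \<and> \<beta> = \<beta>' \<and> \<gamma> = \<gamma>'" by blast
  then show "phi_sumC \<alpha> @ phi_sumC \<gamma> @ [U] @ phi_sumC \<beta> @ [D] =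
      phi_sumC \<alpha>' @ phi_sumC \<gamma>' @ [U] @ phi_sumC \<beta>' @ [D]" by simp
qed (use Dyck_paths_UD Dyck_paths_UUDD Dyck_paths_Nil in \<open>(simp; fail) | blast\<close>)+
termination by (relation "measure length") auto


lemma Dh_subset_Dyck_paths: "Dh \<subseteq> Dyck_paths"
proof
  fix P assume "P \<in> Dh"
  then show "P \<in> Dyck_paths" by induction (auto intro: Dyck_paths_first)
qed

lemma Dhn_subset_Dyck: "Dhn n \<subseteq> Dyck n"
proof
  fix P assume P: "P \<in> Dhn n"
  then obtain m where "P \<in> Dyck m"
    using Dh_subset_Dyck_paths unfolding Dhn_def Dyck_paths_def by blast
  moreover from this P have "m = n" by (simp add: Dhn_def Dyck_def Motzkin_def)
  ultimately show "P \<in> Dyck n" by simp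
qed

lemma Dh_first_return_iff:
  assumes "\<alpha> \<in> Dyck_paths" "\<beta> \<in> Dyck_paths"
  shows "U # \<alpha> @ D # \<beta> \<in> Dh \<longleftrightarrow>
    \<alpha> \<in> Dh \<and> \<beta> \<in> Dh \<and> max_height (U # \<alpha> @ [D]) \<ge> max_height \<beta>"
proof
  assume "U # \<alpha> @ D # \<beta> \<in> Dh"
  then show "\<alpha> \<in> Dh \<and> \<beta> \<in> Dh \<and> max_height (U # \<alpha> @ [D]) \<ge> max_height \<beta>"
  proof cases
    case (first_return \<alpha>' \<beta>')
    then have "\<alpha>' \<in> Dyck_paths" using Dh_subset_Dyck_paths by blast
    with first_return(1) assms(1) have "\<alpha> = \<alpha>'" "\<beta> = \<beta>'"
      using first_return_unique[of \<alpha> \<beta> \<alpha>' \<beta>'] by simp_all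
    with first_return show ?thesis by simp
  qed
qed (auto intro: Dh.first_return)

lemma max_height_append: "max_height v \<le> max_height (v @ w)"
proof -
  have "(\<lambda>k. end_height (take k v)) ` {..length v} \<subseteq>
      (\<lambda>k. end_height (take k (v @ w))) ` {..length (v @ w)}"
  proof
    fix x assume "x \<in> (\<lambda>k. end_height (take k v)) ` {..length v}"
    then obtain k where "k \<le> length v" "x = end_height (take k (v @ w))" by auto
    then show "x \<in> (\<lambda>k. end_height (take k (v @ w))) ` {..length (v @ w)}"
      by (intro image_eqI[of _ _ k]) simp_all
  qed
  then show ?thesis unfolding max_height_def by (intro Max_mono) auto
qed

lemma Dh_appendD:
  assumes "\<alpha> @ \<delta> \<in> Dh" "\<alpha> \<in> Dyck_paths" "\<delta> \<in> Dyck_paths"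
  shows "\<alpha> \<in> Dh \<and> \<delta> \<in> Dh"
  using assms
proof (induction \<alpha> rule: length_induct)
  case (1 \<alpha>)
  show ?case
  proof (cases "\<alpha> = []")
    case False
    with 1 obtain \<beta> \<gamma> where \<alpha>: "\<alpha> = U # \<beta> @ D # \<gamma>" "\<beta> \<in> Dyck_paths" "\<gamma> \<in> Dyck_paths"
      using first_return_exists by blast
    have "U # \<beta> @ D # (\<gamma> @ \<delta>) \<in> Dh" using 1(2) \<alpha>(1) by simp
    then have *: "\<beta> \<in> Dh" "\<gamma> @ \<delta> \<in> Dh" "max_height (\<gamma> @ \<delta>) \<le> max_height (U # \<beta> @ [D])"
      using Dh_first_return_iff[OF \<alpha>(2) Dyck_paths_append[OF \<alpha>(3) 1(4)]] by auto
    have "length \<gamma> < length \<alpha>" using \<alpha>(1) by simp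
    with 1 * \<alpha> have "\<gamma> \<in> Dh" "\<delta> \<in> Dh" by blast+
    moreover have "max_height \<gamma> \<le> max_height (U # \<beta> @ [D])"
      using max_height_append[of \<gamma> \<delta>] *(3) by linarith
    ultimately show ?thesis using \<alpha>(1) *(1) Dh.first_return by blast
  qed (use 1 Dh.empty in auto)
qed

lemma Dh_UD_D: "\<alpha> @ [U, D] \<in> Dh \<Longrightarrow> \<alpha> \<in> Dyck_paths \<Longrightarrow> \<alpha> \<in> Dh"
  using Dh_appendD[of \<alpha> "[U, D]"] Dyck_paths_UD[of "[]"] by simp

lemma Dh_UUDD_D:
  assumes "\<alpha> @ [U, U] @ \<beta> @ [D] @ \<gamma> @ [D] \<in> Dh"
    and "\<alpha> \<in> Dyck_paths" "\<beta> \<in> Dyck_paths" "\<gamma> \<in> Dyck_paths"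
  shows "\<alpha> \<in> Dh \<and> \<beta> \<in> Dh \<and> \<gamma> \<in> Dh"
proof -
  have "\<alpha> \<in> Dh \<and> [U, U] @ \<beta> @ [D] @ \<gamma> @ [D] \<in> Dh"
    using assms Dyck_paths_UUDD[of "[]" \<beta> \<gamma>] by (intro Dh_appendD) simp_all
  then have "\<alpha> \<in> Dh" "U # (U # \<beta> @ D # \<gamma>) @ D # [] \<in> Dh" by simp_all
  then show ?thesis
    using Dh_first_return_iff assms Dyck_paths_first Dyck_paths_Nil by blast
qed

lemma Motzkin_iff:
  "w \<in> Motzkin n \<longleftrightarrow>
     length w = n \<and> end_height w = 0 \<and> (\<forall>u v. w = u @ v \<longrightarrow> 0 \<le> end_height u)"
proof -
  have "(\<forall>k\<le>length w. 0 \<le> end_height (take k w)) \<longleftrightarrow>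
      (\<forall>u v. w = u @ v \<longrightarrow> 0 \<le> end_height u)"
    by (metis append_eq_conv_conj append_take_drop_id le_add1 length_append)
  then show ?thesis by (auto simp: Motzkin_def)
qed

lemma Motzkin_append:
  assumes "v \<in> Motzkin m" "w \<in> Motzkin n"
  shows "v @ w \<in> Motzkin (m + n)"
proof -
  have "0 \<le> end_height u" if "v @ w = u @ x" for u x
  proof -
    from that obtain us where "v = u @ us \<or> v @ us = u \<and> w = us @ x"
      unfolding append_eq_append_conv2 by blast
    then show ?thesis
    proof
      assume "v = u @ us"
      with assms(1) show ?thesis by (auto simp: Motzkin_iff)
    next
      assume *: "v @ us = u \<and> w = us @ x"
      with assms(2) have "0 \<le> end_height us" by (auto simp: Motzkin_iff)
      moreover have "end_height v = 0" using assms(1) by (simp add: Motzkin_iff)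
      ultimately show ?thesis using * by auto
    qed
  qed
  with assms show ?thesis by (simp add: Motzkin_iff)
qed

lemma Motzkin_arch:
  assumes "v \<in> Motzkin m"
  shows "U # v @ [D] \<in> Motzkin (m + 2)"
proof -
  have "0 \<le> end_height u" if eq: "U # v @ [D] = u @ x" for u x
  proof (cases u)
    case (Cons s u')
    with eq have s: "s = U" and "v @ [D] = u' @ x" by auto
    then have "(\<exists>y. v = u' @ y) \<or> u' = v @ [D]"
      by (auto simp: append_eq_append_conv2 Cons_eq_append_conv append_eq_Cons_conv)
    with assms Cons s show ?thesis by (auto simp: Motzkin_iff)
  qed simp
  with assms show ?thesis by (auto simp: Motzkin_iff)
qed

lemma phi_Motzkin:
  assumes "P \<in> Dyck_paths"
  shows "phi P \<in> Motzkin (length P div 2)"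
proof -
  have even: "even (length w)" if "w \<in> Dyck_paths" for w
    using that by (auto simp: Dyck_paths_def Dyck_def Motzkin_def)
  have F: "[F] \<in> Motzkin 1" by (auto simp: Motzkin_def le_Suc_eq)
  show ?thesis using assms
  proof (induction P rule: phi.induct)
    case 1
    show ?case by (simp add: Motzkin_def)
  next
    case (2 \<alpha>)
    then have "phi \<alpha> @ [F] \<in> Motzkin (length \<alpha> div 2 + 1)" using F by (intro Motzkin_append)
    with 2 show ?case by simp
  next
    case (3 \<alpha> \<beta> \<gamma>)
    then have "phi \<alpha> @ phi \<gamma> @ U # phi \<beta> @ [D] \<in>
        Motzkin (length \<alpha> div 2 + (length \<gamma> div 2 + (length \<beta> div 2 + 2)))"
      by (intro Motzkin_append Motzkin_arch)
    moreover have "length (\<alpha> @ [U, U] @ \<beta> @ [D] @ \<gamma> @ [D]) div 2 =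
        length \<alpha> div 2 + (length \<gamma> div 2 + (length \<beta> div 2 + 2))"
      using even[OF 3(1)] even[OF 3(2)] even[OF 3(3)] by (auto elim!: evenE)
    ultimately show ?case
      by (metis phi.simps(3)[OF 3(1-3)] append_Cons append_Nil)
  qed simp
qed

lemma phi_Dhn: "P \<in> Dhn n \<Longrightarrow> phi P \<in> Motzkin n"
  using phi_Motzkin[of P] Dh_subset_Dyck_paths by (auto simp: Dhn_def)

end

theory Submission
  imports Defs "HOL-Library.Sublist"
begin

text \<open>
  Both sides are computed along the recursion defining \<^const>\<open>phi\<close>. For \<open>\<alpha> U D\<close> the new
  occurrence of \<open>UDU\<close> matches a new \<open>FF\<close>, since \<open>\<alpha>\<close> ends in \<open>UD\<close> iff its image ends in \<open>F\<close>.
  For \<open>\<alpha> U U \<beta> D \<gamma> D\<close> the height condition forbids \<open>\<alpha>\<close> to end in \<open>UD\<close>, so nothing is created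
  at the end of \<open>\<alpha>\<close> or of its image; and if \<open>\<beta>\<close> is empty, then \<open>\<gamma>\<close> has height at most one, so
  for \<open>\<gamma> \<noteq> \<epsilon>\<close> the factor \<open>UDU\<close> created before \<open>\<gamma>\<close> matches the \<open>FUD\<close> created after its image.
\<close>

lemma occ_Nil [simp]: "X \<noteq> [] \<Longrightarrow> occ X [] = 0"
  by (simp add: occ_def)

text \<open>An occurrence either starts at position 0, which is the prefix test, or is an occurrence
  in \<open>w\<close> shifted by one.\<close>

lemma occ_Cons:
  "occ X (s # w) = of_bool (prefix X (s # w)) + occ X w"
proof -
  define A where "A w = {i. i + length X \<le> length w \<and> take (length X) (drop i w) = X}" for w
  have fin: "finite (A w)"
    by (rule finite_subset[of _ "{..length w}"]) (auto simp: A_def)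
  have zero: "0 \<in> A (s # w) \<longleftrightarrow> prefix X (s # w)"
    using take_is_prefix[of "length X" "s # w"] prefix_length_le[of X "s # w"]
    by (auto simp: A_def prefix_def append_eq_conv_conj simp del: take_Suc_Cons)
  have suc: "Suc i \<in> A (s # w) \<longleftrightarrow> i \<in> A w" for i
    by (simp add: A_def)
  have "A (s # w) = (if prefix X (s # w) then {0} else {}) \<union> Suc ` A w"
  proof (rule set_eqI)
    fix i
    show "i \<in> A (s # w) \<longleftrightarrow> i \<in> (if prefix X (s # w) then {0} else {}) \<union> Suc ` A w"
      by (cases i) (simp_all add: zero suc inj_image_mem_iff image_iff)
  qed
  moreover have "card (Suc ` A w) = card (A w)" by (simp add: card_image)
  ultimately have "card (A (s # w)) = of_bool (prefix X (s # w)) + card (A w)"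
    using fin by auto
  then show ?thesis by (simp add: occ_def A_def)
qed

lemma occ_append2:
  "occ [a, b] (v @ w) = occ [a, b] v + occ [a, b] w + of_bool (suffix [a] v \<and> prefix [b] w)"
proof (induction v)
  case (Cons s v)
  then show ?case by (cases v) (auto simp: occ_Cons suffix_Cons)
qed simp

text \<open>A factor straddling the junction is cut either after its second or after its first
  letter, hence the two correction terms.\<close>

lemma occ_append3:
  "occ [a, b, c] (v @ w) = occ [a, b, c] v + occ [a, b, c] w +
     of_bool (suffix [a, b] v \<and> prefix [c] w) + of_bool (suffix [a] v \<and> prefix [b, c] w)"
proof (induction v)
  case (Cons s v)
  then show ?case
    by (cases v; cases "tl v") (auto simp: occ_Cons suffix_Cons)
qed simp

lemma Dyck_paths_Cons_U:
  assumes "w \<in> Dyck_paths" "w \<noteq> []"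
  obtains v where "w = U # v"
  using first_return_exists[OF assms] by blast

lemma Dyck_paths_suffix:
  assumes "w \<in> Dyck_paths" "suffix [s] w"
  shows "s = D"
proof -
  from assms(2) have "w \<noteq> []" by auto
  from last_return_exists[OF assms(1) this] obtain v where "w = v @ [D]" by fastforce
  with assms(2) show ?thesis by (auto simp: suffix_def)
qed

lemma phi_UUDD:
  assumes "\<alpha> \<in> Dyck_paths" "\<beta> \<in> Dyck_paths" "\<gamma> \<in> Dyck_paths"
  shows "phi (\<alpha> @ U # U # \<beta> @ D # \<gamma> @ [D]) = phi \<alpha> @ phi \<gamma> @ U # phi \<beta> @ [D]"
  using phi.simps(3)[OF assms] by simp

lemma Dyck_paths_suffix_UD:
  assumes "w \<in> Dyck_paths" "suffix [U, D] w"
  obtains v where "v \<in> Dyck_paths" "w = v @ [U, D]"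
proof (rule phi_cases[of w])
  fix \<alpha> \<beta> \<gamma>
  assume *: "\<alpha> \<in> Dyck_paths" "\<beta> \<in> Dyck_paths" "\<gamma> \<in> Dyck_paths"
    "w = \<alpha> @ [U, U] @ \<beta> @ [D] @ \<gamma> @ [D]"
  obtain u where "w = u @ [U, D]" using assms(2) by (auto simp: suffix_def)
  with *(4) have "\<alpha> @ [U, U] @ \<beta> @ [D] @ \<gamma> = u @ [U]" by simp
  then have "suffix [U] (\<alpha> @ [U, U] @ \<beta> @ [D] @ \<gamma>)" by simp
  \<comment> \<open>If \<gamma> were empty, the last step would be the \<open>D\<close> closing
    \<beta>, not \<open>U\<close>.\<close>
  then have "suffix [U] \<gamma>" by (cases \<gamma> rule: rev_cases) (auto simp: suffix_def)
  with Dyck_paths_suffix *(3) show thesis by blast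
qed (use assms that in auto)

text \<open>The two nonempty cases of \<open>phi\<close> produce a final \<open>F\<close> and a
  final \<open>D\<close>, and only the first applies to a path ending in \<open>U D\<close>.\<close>

lemma suffix_F_phi_iff:
  assumes "w \<in> Dyck_paths"
  shows "suffix [F] (phi w) \<longleftrightarrow> suffix [U, D] w"
proof (rule phi_cases[of w])
  fix \<alpha> \<beta> \<gamma>
  assume *: "\<alpha> \<in> Dyck_paths" "\<beta> \<in> Dyck_paths" "\<gamma> \<in> Dyck_paths"
    "w = \<alpha> @ [U, U] @ \<beta> @ [D] @ \<gamma> @ [D]"
  have "\<not> suffix [U, D] w"
    using Dyck_paths_suffix_UD[OF assms] UD_UUDD_disjoint * by metis
  moreover have "\<not> suffix [F] (phi w)"
    using phi_UUDD[OF *(1-3)] *(4) by (auto simp: suffix_def)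
  ultimately show ?thesis by blast
qed (use assms in \<open>auto simp: suffix_def\<close>)

lemma phi_eq_Nil_iff:
  assumes "w \<in> Dyck_paths"
  shows "phi w = [] \<longleftrightarrow> w = []"
proof
  assume "phi w = []"
  then have "length w div 2 = 0" using phi_Motzkin[OF assms] by (simp add: Motzkin_def)
  \<comment> \<open>The quotient 0 still allows length 1, but a nonempty Dyck path has at least two
    steps.\<close>
  then show "w = []" using first_return_exists[OF assms] by fastforce
qed simp

lemma end_height_le_max_height: "end_height v \<le> max_height (v @ w)"
  unfolding max_height_def
  by (rule Max_ge) (auto intro!: image_eqI[of _ _ "length v"])

lemma max_height_UD: "max_height [U, D] = 1"
proof -
  have "{..length [U, D]} = {0, 1, 2}" by auto
  then show ?thesis by (simp add: max_height_def)
qed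

lemma Dh_UUDD_not_suffix_UD:
  assumes "\<alpha> @ [U, U] @ \<beta> @ [D] @ \<gamma> @ [D] \<in> Dh"
    and "\<alpha> \<in> Dyck_paths" "\<beta> \<in> Dyck_paths" "\<gamma> \<in> Dyck_paths"
  shows "\<not> suffix [U, D] \<alpha>"
proof
  assume "suffix [U, D] \<alpha>"
  with assms(2) obtain \<delta> where \<delta>: "\<delta> \<in> Dyck_paths" "\<alpha> = \<delta> @ [U, D]"
    using Dyck_paths_suffix_UD by blast
  let ?w = "[U, U] @ \<beta> @ [D] @ \<gamma> @ [D]"
  have w: "?w \<in> Dyck_paths" using Dyck_paths_UUDD[of "[]"] assms by simp
  \<comment> \<open>Dropping \<delta> makes the final \<open>U D\<close> of \<alpha> the first arch,
    of height 1, while the rest \<open>?w\<close> starts with \<open>U U\<close> and reaches height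
    2.\<close>
  have "U # [] @ D # ?w \<in> Dh"
    using Dh_appendD[of \<delta> "U # [] @ D # ?w"] Dyck_paths_first[OF _ w, of "[]"] assms(1) \<delta>
    by simp
  then have "max_height ?w \<le> max_height [U, D]"
    using Dh_first_return_iff[OF _ w, of "[]"] by simp
  with end_height_le_max_height[of "[U, U]" "\<beta> @ [D] @ \<gamma> @ [D]"] show False
    by (simp add: max_height_UD)
qed

text \<open>In the other nonempty case of \<open>phi\<close>, the path is at height 2 right after
  \<alpha> and \<open>U U\<close>.\<close>

lemma max_height_le_1_suffix_UD:
  assumes "w \<in> Dyck_paths" "w \<noteq> []" "max_height w \<le> 1"
  shows "suffix [U, D] w"
proof (rule phi_cases[of w])
  fix \<alpha> \<beta> \<gamma>
  assume *: "\<alpha> \<in> Dyck_paths" "w = \<alpha> @ [U, U] @ \<beta> @ [D] @ \<gamma> @ [D]"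
  with end_height_le_max_height[of "\<alpha> @ [U, U]" "\<beta> @ [D] @ \<gamma> @ [D]"] assms(3)
  show ?thesis by (simp add: Dyck_paths_iff)
qed (use assms in \<open>auto simp: suffix_def\<close>)

lemma Dh_UUDD_suffix_UD:
  assumes "\<alpha> @ [U, U] @ [D] @ \<gamma> @ [D] \<in> Dh"
    and "\<alpha> \<in> Dyck_paths" "\<gamma> \<in> Dyck_paths" "\<gamma> \<noteq> []"
  shows "suffix [U, D] \<gamma>"
proof -
  let ?v = "U # [] @ D # \<gamma>"
  have v: "?v \<in> Dyck_paths" using Dyck_paths_first[of "[]"] assms(3) by simp
  \<comment> \<open>Once \<alpha> is dropped, a single arch remains; its interior \<open>?v\<close>
    has first arch \<open>U D\<close>, which bounds the height of \<gamma>.\<close>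
  have "U # ?v @ D # [] \<in> Dh"
    using Dh_appendD[of \<alpha> "U # ?v @ D # []"] Dyck_paths_arch[OF v] assms by simp
  then have "?v \<in> Dh" using Dh_first_return_iff[OF v Dyck_paths_Nil] by blast
  then have "max_height \<gamma> \<le> 1"
    using Dh_first_return_iff[of "[]" \<gamma>] assms(3) by (simp add: max_height_UD)
  then show ?thesis using max_height_le_1_suffix_UD assms by blast
qed

text \<open>The only possible new factor consists of the second \<open>U\<close>, the
  \<open>D\<close> closing an empty \<beta> and the first step of \<gamma>; the last hypothesis
  blocks the junction after \<alpha>.\<close>

lemma occ_UDU_UUDD:
  assumes "\<beta> \<in> Dyck_paths" "\<gamma> \<in> Dyck_paths" "\<not> suffix [U, D] \<alpha>"
  shows "occ [U, D, U] (\<alpha> @ U # U # \<beta> @ D # \<gamma> @ [D]) =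
    occ [U, D, U] \<alpha> + occ [U, D, U] \<beta> + occ [U, D, U] \<gamma> + of_bool (\<beta> = [] \<and> \<gamma> \<noteq> [])"
proof -
  have "prefix [D, U] (\<beta> @ D # \<gamma> @ [D]) \<longleftrightarrow> \<beta> = [] \<and> \<gamma> \<noteq> []"
    using assms(1,2) by (cases "\<beta> = []"; cases "\<gamma> = []") (auto elim!: Dyck_paths_Cons_U)
  moreover have "\<not> suffix [U] \<beta>" using assms(1) Dyck_paths_suffix by blast
  ultimately show ?thesis using assms(3) by (simp add: occ_append3 occ_Cons)
qed

lemma Motzkin_not_prefix_D:
  assumes "w \<in> Motzkin n"
  shows "\<not> prefix [D] w"
proof
  assume "prefix [D] w"
  then have "0 \<le> end_height [D]" using assms unfolding Motzkin_iff prefix_def by blast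
  then show False by simp
qed

lemma Motzkin_not_suffix_U:
  assumes "w \<in> Motzkin n"
  shows "\<not> suffix [U] w"
proof
  assume "suffix [U] w"
  then obtain v where "w = v @ [U]" by (auto simp: suffix_def)
  moreover from this assms have "0 \<le> end_height v" by (simp add: Motzkin_iff)
  ultimately show False using assms by (simp add: Motzkin_iff)
qed

text \<open>As \<open>a\<close> does not end in \<open>F\<close> and \<open>c\<close> does not start
  with \<open>D\<close>, nothing arises after \<open>a\<close>, even if \<open>c\<close> is empty.
  As \<open>b\<close> does not end in \<open>U\<close>, only \<open>U D\<close> with
  \<open>b\<close> empty can complete a new factor, after a final \<open>F\<close> of
  \<open>c\<close>.\<close>

lemma occ_FF_FUD_UUDD:
  assumes "b \<in> Motzkin l" "c \<in> Motzkin m" "\<not> suffix [F] a"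
  shows "occ [F, F] (a @ c @ U # b @ [D]) + occ [F, U, D] (a @ c @ U # b @ [D]) =
    occ [F, F] a + occ [F, U, D] a + (occ [F, F] b + occ [F, U, D] b) +
    (occ [F, F] c + occ [F, U, D] c) + of_bool (b = [] \<and> suffix [F] c)"
proof -
  have "prefix [D] (b @ [D]) \<longleftrightarrow> b = []"
    using Motzkin_not_prefix_D[OF assms(1)] by (cases b) auto
  moreover have "\<not> suffix [F, U] a \<or> \<not> prefix [D] (c @ U # b @ [D])"
    using Motzkin_not_prefix_D[OF assms(2)] by (cases c) auto
  moreover have "\<not> suffix [F, U] b"
    using Motzkin_not_suffix_U[OF assms(1)] by (auto simp: suffix_def)
  ultimately show ?thesis using assms(3) by (auto simp: occ_append2 occ_append3 occ_Cons)
qed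

theorem theorem8:
  fixes n :: nat and P :: path
  assumes "P \<in> Dhn n"
  shows "occ [U, D, U] P = occ [F, F] (phi P) + occ [F, U, D] (phi P)"
proof -
  have "P \<in> Dh" using assms by (simp add: Dhn_def)
  then show ?thesis
  proof (induction P rule: phi.induct)
    case 1
    show ?case by simp
  next
    case (2 \<alpha>)
    have "\<alpha> \<in> Dh" using 2 Dh_UD_D by blast
    moreover have "\<not> suffix [U] \<alpha>" using 2(1) Dyck_paths_suffix by blast
    ultimately show ?case
      using 2(2) suffix_F_phi_iff[OF 2(1)]
      by (simp add: phi.simps(2)[OF 2(1)] occ_append2 occ_append3 occ_Cons)
  next
    case (3 \<alpha> \<beta> \<gamma>)
    have Dh: "\<alpha> \<in> Dh" "\<beta> \<in> Dh" "\<gamma> \<in> Dh" using Dh_UUDD_D 3 by blast+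
    have \<alpha>: "\<not> suffix [U, D] \<alpha>" using Dh_UUDD_not_suffix_UD 3 by blast
    \<comment> \<open>From left to right this uses the height condition; conversely, a \<gamma>
      whose image ends in \<open>F\<close> ends in \<open>U D\<close>, so it is nonempty.\<close>
    have "\<beta> = [] \<and> \<gamma> \<noteq> [] \<longleftrightarrow> phi \<beta> = [] \<and> suffix [F] (phi \<gamma>)"
      using Dh_UUDD_suffix_UD[of \<alpha> \<gamma>] 3 by (auto simp: phi_eq_Nil_iff suffix_F_phi_iff)
    then have "occ [U, D, U] (\<alpha> @ U # U # \<beta> @ D # \<gamma> @ [D]) =
        occ [F, F] (phi \<alpha> @ phi \<gamma> @ U # phi \<beta> @ [D]) +
        occ [F, U, D] (phi \<alpha> @ phi \<gamma> @ U # phi \<beta> @ [D])"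
      using occ_FF_FUD_UUDD[OF phi_Motzkin[OF 3(2)] phi_Motzkin[OF 3(3)], of "phi \<alpha>"]
        occ_UDU_UUDD[OF 3(2,3) \<alpha>] \<alpha> 3 Dh by (simp add: suffix_F_phi_iff)
    then show ?case by (simp add: phi_UUDD[OF 3(1-3)])
  next
    case (4 w)
    then show ?case using Dh_subset_Dyck_paths by blast
  qed
qed

end
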